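(* For all integers $n\ge k\ge 0$, $$H_{\lambda}^{Y}(n,k)=\frac{1}{k!}\sum_{j=0}^{k}\binom{k}{j}(-1)^{k-j}E\big[\langle S_{j}\rangle_{n,\lambda}\big].$$
   Context: Let $Y$ be a real random variable with $E[|Y|^{n}]<\infty$ for all integers $n\ge 0$ and $\lim_{n\to\infty}|t|^{n}E[|Y|^{n}]/n!=0$ for $|t|<r$, for some $r>0$. Let $Y_1,Y_2,\dots$ be i.i.d. copies of $Y$, $S_0=0$ and $S_k=Y_1+\cdots+Y_k$ for $k\ge1$. Fix a nonzero real $\lambda$. For real $x$ put $\langle x\rangle_{0,\lambda}=1$, $\langle x\rangle_{n,\lambda}=x(x+\lambda)(x+2\lambda)\cdots(x+(n-1)\lambda)$ for $n\ge1$. The degenerate exponential is $e_\lambda^{x}(t)=(1+\lambda t)^{x/\lambda}$, so that $e_\lambda^{-x}(-t)=(1-\lambda t)^{-x/\lambda}=\sum_{n\ge0}\langle x\rangle_{n,\lambda}t^n/n!$ and $E[e_\lambda^{-Y}(-t)]=\sum_{n\ge0}E[\langle Y\rangle_{n,\lambda}]t^n/n!$ for $t$ near $0$. The probabilistic heterogeneous Stirling numbers of the second kind $H_\lambda^Y(n,k)$ ($n\ge k\ge 0$) are defined by $$\frac{1}{k!}\Big(E\big[e_{\lambda}^{-Y}(-t)\big]-1\Big)^{k}=\sum_{n=k}^{\infty}H_{\lambda}^{Y}(n,k)\frac{t^{n}}{n!}.$$ *)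

theory Defs
  imports "HOL-Probability.Probability"
begin

definition deg_rising_fact :: "real \<Rightarrow> real \<Rightarrow> nat \<Rightarrow> real" where
  "deg_rising_fact lam x n = (\<Prod>i<n. x + real i * lam)"

definition deg_exp :: "real \<Rightarrow> real \<Rightarrow> real \<Rightarrow> real" where
  "deg_exp lam x t = (1 + lam * t) powr (x / lam)"

text \<open>
  The generating function is an actual function of the real variable \<open>t\<close>, and the numbers are
  read off its power series expansion at \<open>0\<close>. The coefficients with \<open>n < k\<close> vanish automatically,
  because the expectation below equals \<open>1\<close> at \<open>t = 0\<close>.
\<close>

definition prob_het_stirling2 ::
  "'a measure \<Rightarrow> ('a \<Rightarrow> real) \<Rightarrow> real \<Rightarrow> nat \<Rightarrow> nat \<Rightarrow> real" where
  "prob_het_stirling2 M Y lam n k =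
     fact n * fps_nth
       (THE F. (\<lambda>t::real. 1 / fact k * ((\<integral>\<omega>. deg_exp lam (- Y \<omega>) (- t) \<partial>M) - 1) ^ k)
                 has_fps_expansion F) n"

end

theory Submission
  imports Defs "HOL-Complex_Analysis.Laurent_Convergence"
begin

text \<open>
  The series \<open>(1 - \<lambda>t) powr (-Y/\<lambda>) = (\<Sum>n. \<langle>Y\<rangle>\<^sub>n t\<^sup>n / n!)\<close> is majorised termwise by the series of
  \<open>(1 - \<bar>\<lambda>t\<bar>) powr (-\<bar>Y\<bar>/\<bar>\<lambda>\<bar>) = exp (v \<bar>Y\<bar>)\<close>, where \<open>v = -ln (1 - \<bar>\<lambda>t\<bar>) / \<bar>\<lambda>\<bar>\<close> tends to \<open>0\<close> with \<open>t\<close>.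
  The moment condition makes \<open>exp (v \<bar>Y\<bar>)\<close> integrable for \<open>v < r\<close>, so expectation and summation
  commute, and the generating function has the expansion \<open>A = (\<Sum>n. E \<langle>Y\<rangle>\<^sub>n t\<^sup>n / n!)\<close>.
  By the Vandermonde identity for rising factorials and independence, \<open>A ^ j\<close> is the
  corresponding series of \<open>S\<^sub>j\<close>; the formula is the binomial expansion of \<open>(A - 1) ^ k\<close>.
\<close>

section \<open>Uniqueness of power series expansions\<close>

lemma has_fps_expansion_zero_imp_zero:
  fixes F :: "'a :: {banach, real_normed_field} fps"
  assumes "(\<lambda>_. 0) has_fps_expansion F"
  shows "F = 0"
proof (rule ccontr)
  assume "F \<noteq> 0"
  define c where "c = fps_nth F (subdegree F)"
  have "c \<noteq> 0" using \<open>F \<noteq> 0\<close> by (simp add: c_def)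
  \<comment> \<open>Dividing out the leading power leaves a series with constant term
    \<open>c\<close>. Its function is 0 away from the origin, yet continuity there forces the limit
    \<open>c\<close>, which is nonzero.\<close>
  have "(\<lambda>x. if x = 0 then c else 0 / x ^ subdegree F) has_fps_expansion fps_shift (subdegree F) F"
    by (rule has_fps_expansion_shift[OF assms]) (auto simp: c_def)
  from has_fps_expansion_imp_continuous[OF this, of UNIV]
  have "((\<lambda>x::'a. if x = 0 then c else 0 / x ^ subdegree F) \<longlongrightarrow> c) (at 0)"
    by (simp add: isCont_def)
  moreover have "((\<lambda>x::'a. if x = 0 then c else 0 / x ^ subdegree F) \<longlongrightarrow> 0) (at 0)"
    by (rule tendsto_eventually) (auto simp: eventually_at_filter)
  ultimately show False
    using tendsto_unique[OF at_neq_bot] \<open>c \<noteq> 0\<close> by blast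
qed

text \<open>This is what lets the \<open>THE\<close> in \<open>prob_het_stirling2\<close> be
  evaluated: any expansion that is exhibited is the one selected.\<close>

lemma has_fps_expansion_unique:
  fixes F G :: "'a :: {banach, real_normed_field} fps"
  assumes "f has_fps_expansion F" "f has_fps_expansion G"
  shows "F = G"
  using has_fps_expansion_zero_imp_zero[of "F - G"] has_fps_expansion_diff[OF assms] by simp

section \<open>Rising factorials and their exponential generating series\<close>

lemma deg_rising_fact_eq_pochhammer:
  assumes "lam \<noteq> 0"
  shows "deg_rising_fact lam x n = lam ^ n * pochhammer (x / lam) n"
proof -
  have "lam ^ n * pochhammer (x / lam) n = (\<Prod>i<n. lam) * (\<Prod>i<n. x / lam + real i)"
    by (simp add: pochhammer_prod atLeast0LessThan)
  also have "\<dots> = (\<Prod>i<n. lam * (x / lam + real i))"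
    by (rule prod.distrib[symmetric])
  finally show ?thesis
    using assms by (simp add: deg_rising_fact_def algebra_simps)
qed

text \<open>For nonzero \<open>lam\<close> this is the Taylor series at 0 of
  \<open>(1 - lam * t) powr (- x / lam)\<close> in \<open>t\<close>. As a formal series it can be
  multiplied without convergence questions.\<close>

definition deg_rising_fps :: "real \<Rightarrow> real \<Rightarrow> real fps" where
  "deg_rising_fps lam x = Abs_fps (\<lambda>n. deg_rising_fact lam x n / fact n)"

lemma deg_rising_fps_nth [simp]: "fps_nth (deg_rising_fps lam x) n = deg_rising_fact lam x n / fact n"
  by (simp add: deg_rising_fps_def)

text \<open>The Vandermonde identity for \<open>pochhammer\<close>: division by factorials turns its
  binomial convolution into the Cauchy product.\<close>

lemma deg_rising_fps_add:
  assumes "lam \<noteq> 0"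
  shows "deg_rising_fps lam (x + y) = deg_rising_fps lam x * deg_rising_fps lam y"
proof (rule fps_ext)
  fix n
  have "deg_rising_fact lam (x + y) n / fact n =
      (\<Sum>i\<le>n. lam ^ n * (real (n choose i) * pochhammer (x / lam) i * pochhammer (y / lam) (n - i)) / fact n)"
    using assms
    by (simp add: deg_rising_fact_eq_pochhammer add_divide_distrib pochhammer_binomial_sum
        sum_distrib_left sum_divide_distrib)
  also have "\<dots> = (\<Sum>i\<le>n. deg_rising_fact lam x i / fact i * (deg_rising_fact lam y (n - i) / fact (n - i)))"
  proof (rule sum.cong[OF refl])
    fix i assume "i \<in> {..n}"
    hence i: "i \<le> n" by simp
    have "lam ^ n = lam ^ i * lam ^ (n - i)"
      using i by (simp flip: power_add)
    thus "lam ^ n * (real (n choose i) * pochhammer (x / lam) i * pochhammer (y / lam) (n - i)) / fact n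
        = deg_rising_fact lam x i / fact i * (deg_rising_fact lam y (n - i) / fact (n - i))"
      using assms i by (simp add: deg_rising_fact_eq_pochhammer binomial_fact field_simps)
  qed
  finally show "fps_nth (deg_rising_fps lam (x + y)) n
      = fps_nth (deg_rising_fps lam x * deg_rising_fps lam y) n"
    by (simp add: fps_mult_nth atLeast0AtMost)
qed

text \<open>Newton's binomial series with exponent \<open>- x / lam\<close>. The sign
  \<open>(- 1) ^ n\<close> from the generalised binomial coefficient cancels the one from
  \<open>(- lam * t) ^ n\<close>.\<close>

lemma deg_rising_fps_sums:
  assumes "lam \<noteq> 0" "\<bar>lam * t\<bar> < 1"
  shows "(\<lambda>n. deg_rising_fact lam x n / fact n * t ^ n) sums (1 - lam * t) powr (- x / lam)"
proof -
  have "(\<lambda>n. (- x / lam gchoose n) * (- lam * t) ^ n) sums (1 + - lam * t) powr (- x / lam)"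
    using assms by (intro gen_binomial_real) simp
  moreover have "(- x / lam gchoose n) * (- lam * t) ^ n = deg_rising_fact lam x n / fact n * t ^ n" for n
  proof -
    have "(- lam * t) ^ n = (- 1) ^ n * lam ^ n * t ^ n"
      by (simp flip: power_mult_distrib)
    moreover have "(- 1 :: real) ^ n * (- 1) ^ n = 1"
      by (simp flip: power_mult_distrib)
    ultimately show ?thesis
      using assms(1) by (simp add: gbinomial_pochhammer deg_rising_fact_eq_pochhammer)
  qed
  ultimately show ?thesis by simp
qed

text \<open>The triangle inequality in each factor; the bound supplies the coefficients of the
  majorant series.\<close>

lemma abs_deg_rising_fact_le: "\<bar>deg_rising_fact lam x n\<bar> \<le> deg_rising_fact \<bar>lam\<bar> \<bar>x\<bar> n"
  unfolding deg_rising_fact_def abs_prod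
  by (intro prod_mono conjI order.trans[OF abs_triangle_ineq]) (auto simp: abs_mult)

lemma borel_measurable_deg_rising_fact [measurable]:
  "(\<lambda>x. deg_rising_fact lam x n) \<in> borel_measurable borel"
  unfolding deg_rising_fact_def by measurable

section \<open>Exponential moments and the exchange of expectation and summation\<close>

lemma integrable_exp_abs:
  fixes Y :: "'a \<Rightarrow> real"
  assumes "\<And>m::nat. integrable M (\<lambda>\<omega>. \<bar>Y \<omega>\<bar> ^ m)"
    and lim: "\<And>t::real. \<bar>t\<bar> < r \<Longrightarrow>
           (\<lambda>m. \<bar>t\<bar> ^ m * (\<integral>\<omega>. \<bar>Y \<omega>\<bar> ^ m \<partial>M) / fact m) \<longlonglongrightarrow> 0"
    and v: "0 \<le> v" "v < r"
  shows "integrable M (\<lambda>\<omega>. exp (v * \<bar>Y \<omega>\<bar>))"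
proof -
  \<comment> \<open>A point strictly between \<open>v\<close> and \<open>r\<close>. The moment
    condition at \<open>s\<close> only bounds the terms eventually by 1; stepping down to
    \<open>v\<close> gains the geometric factor \<open>(v / s) ^ m\<close>.\<close>
  define s where "s = (v + r) / 2"
  define E where "E m = (\<integral>\<omega>. \<bar>Y \<omega>\<bar> ^ m \<partial>M)" for m
  have s: "v < s" "s < r" "0 < s" using v by (auto simp: s_def)
  have E: "E m \<ge> 0" for m by (simp add: E_def)
  have "(\<lambda>m. s ^ m * E m / fact m) \<longlonglongrightarrow> 0"
    using lim[of s] s by (simp add: E_def)
  hence "eventually (\<lambda>m. s ^ m * E m / fact m < 1) sequentially"
    by (rule order_tendstoD) simp
  hence "eventually (\<lambda>m. norm (v ^ m * E m / fact m) \<le> (v / s) ^ m) sequentially"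
  proof eventually_elim
    case (elim m)
    have "v ^ m * E m / fact m = (v / s) ^ m * (s ^ m * E m / fact m)"
      using s by (simp add: power_divide)
    also have "\<dots> \<le> (v / s) ^ m * 1"
      using elim v s by (intro mult_left_mono) auto
    finally show ?case using v E by simp
  qed
  moreover have "summable (\<lambda>m. (v / s) ^ m)"
    using v s by (intro summable_geometric) simp
  ultimately have sumE: "summable (\<lambda>m. v ^ m * E m / fact m)"
    by (rule summable_comparison_test_ev)
  have norm_eq: "norm (\<bar>y\<bar> ^ m * (v ^ m / fact m)) = \<bar>y\<bar> ^ m * (v ^ m / fact m)" for y :: real and m
    using v by simp
  have sums: "(\<lambda>m. \<bar>y\<bar> ^ m * (v ^ m / fact m)) sums exp (v * \<bar>y\<bar>)" for y :: real
    using exp_converges[of "v * \<bar>y\<bar>"] by (simp add: power_mult_distrib field_simps)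
  have "integrable M (\<lambda>\<omega>. \<Sum>m. \<bar>Y \<omega>\<bar> ^ m * (v ^ m / fact m))"
  proof (rule integrable_suminf)
    show "integrable M (\<lambda>\<omega>. \<bar>Y \<omega>\<bar> ^ m * (v ^ m / fact m))" for m
      using assms(1) by (rule integrable_mult_left)
    show "AE \<omega> in M. summable (\<lambda>m. norm (\<bar>Y \<omega>\<bar> ^ m * (v ^ m / fact m)))"
      unfolding norm_eq using sums by (auto simp: sums_iff)
    show "summable (\<lambda>m. \<integral>\<omega>. norm (\<bar>Y \<omega>\<bar> ^ m * (v ^ m / fact m)) \<partial>M)"
      unfolding norm_eq using sumE by (simp add: E_def mult.commute)
  qed
  thus ?thesis using sums by (simp add: sums_iff)
qed

text \<open>The binomial series at \<open>\<bar>lam\<bar>\<close>, \<open>\<bar>t\<bar>\<close>,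
  \<open>\<bar>x\<bar>\<close>. Writing its sum as an exponential brings it into the form treated by
  \<open>integrable_exp_abs\<close>.\<close>

lemma deg_rising_majorant:
  fixes lam t x :: real
  assumes "lam \<noteq> 0" "\<bar>lam * t\<bar> < 1"
  defines "v \<equiv> - ln (1 - \<bar>lam * t\<bar>) / \<bar>lam\<bar>"
  shows "(\<lambda>n. deg_rising_fact \<bar>lam\<bar> \<bar>x\<bar> n / fact n * \<bar>t\<bar> ^ n) sums exp (v * \<bar>x\<bar>)"
proof -
  have "(1 - \<bar>lam\<bar> * \<bar>t\<bar>) powr (- \<bar>x\<bar> / \<bar>lam\<bar>) = exp (v * \<bar>x\<bar>)"
    using assms by (simp add: powr_def abs_mult mult.commute)
  thus ?thesis
    using deg_rising_fps_sums[of "\<bar>lam\<bar>" "\<bar>t\<bar>" "\<bar>x\<bar>"] assms by (simp add: abs_mult)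
qed

text \<open>A single term of the nonnegative majorant series is at most its sum, which is
  integrable; since \<open>t\<close> is nonzero, the factor \<open>\<bar>t\<bar> ^ n\<close> can
  then be divided out.\<close>

lemma integrable_deg_rising_fact:
  fixes Y :: "'a \<Rightarrow> real"
  assumes [measurable]: "Y \<in> borel_measurable M"
    and "lam \<noteq> 0" "\<bar>lam * t\<bar> < 1" "t \<noteq> 0"
    and int: "integrable M (\<lambda>\<omega>. exp (- ln (1 - \<bar>lam * t\<bar>) / \<bar>lam\<bar> * \<bar>Y \<omega>\<bar>))"
  shows "integrable M (\<lambda>\<omega>. deg_rising_fact lam (Y \<omega>) n)"
proof -
  have "integrable M (\<lambda>\<omega>. deg_rising_fact lam (Y \<omega>) n / fact n * \<bar>t\<bar> ^ n)"
  proof (rule Bochner_Integration.integrable_bound[OF int])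
    show "AE \<omega> in M. norm (deg_rising_fact lam (Y \<omega>) n / fact n * \<bar>t\<bar> ^ n)
        \<le> norm (exp (- ln (1 - \<bar>lam * t\<bar>) / \<bar>lam\<bar> * \<bar>Y \<omega>\<bar>))"
    proof (rule AE_I2)
      fix \<omega>
      note maj = deg_rising_majorant[OF assms(2,3), of "Y \<omega>"]
      have nonneg: "0 \<le> deg_rising_fact \<bar>lam\<bar> \<bar>Y \<omega>\<bar> i" for i
        by (rule order.trans[OF abs_ge_zero abs_deg_rising_fact_le])
      have "norm (deg_rising_fact lam (Y \<omega>) n / fact n * \<bar>t\<bar> ^ n)
          \<le> deg_rising_fact \<bar>lam\<bar> \<bar>Y \<omega>\<bar> n / fact n * \<bar>t\<bar> ^ n"
        by (simp add: abs_mult power_abs divide_right_mono mult_right_mono abs_deg_rising_fact_le)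
      also have "\<dots> = (\<Sum>i\<in>{n}. deg_rising_fact \<bar>lam\<bar> \<bar>Y \<omega>\<bar> i / fact i * \<bar>t\<bar> ^ i)"
        by simp
      also have "\<dots> \<le> (\<Sum>i. deg_rising_fact \<bar>lam\<bar> \<bar>Y \<omega>\<bar> i / fact i * \<bar>t\<bar> ^ i)"
        using maj nonneg by (intro sum_le_suminf) (auto simp: sums_iff)
      finally show "norm (deg_rising_fact lam (Y \<omega>) n / fact n * \<bar>t\<bar> ^ n)
          \<le> norm (exp (- ln (1 - \<bar>lam * t\<bar>) / \<bar>lam\<bar> * \<bar>Y \<omega>\<bar>))"
        using maj by (simp add: sums_iff)
    qed
  qed measurable
  from integrable_mult_left[OF this, of "fact n / \<bar>t\<bar> ^ n"] show ?thesis
    using assms(4) by simp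
qed

lemma deg_exp_integral_sums:
  fixes Y :: "'a \<Rightarrow> real"
  assumes Y [measurable]: "Y \<in> borel_measurable M"
    and lam: "lam \<noteq> 0" and t: "\<bar>lam * t\<bar> < 1"
    and int: "integrable M (\<lambda>\<omega>. exp (- ln (1 - \<bar>lam * t\<bar>) / \<bar>lam\<bar> * \<bar>Y \<omega>\<bar>))"
    and int': "\<And>n. integrable M (\<lambda>\<omega>. deg_rising_fact lam (Y \<omega>) n)"
  shows "(\<lambda>n. (\<integral>\<omega>. deg_rising_fact lam (Y \<omega>) n \<partial>M) / fact n * t ^ n)
    sums (\<integral>\<omega>. deg_exp lam (- Y \<omega>) (- t) \<partial>M)"
proof -
  define f where "f n \<omega> = deg_rising_fact lam (Y \<omega>) n / fact n * t ^ n" for n \<omega>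
  note maj = deg_rising_majorant[OF lam t]
  have f_le: "norm (f n \<omega>) \<le> deg_rising_fact \<bar>lam\<bar> \<bar>Y \<omega>\<bar> n / fact n * \<bar>t\<bar> ^ n" for n \<omega>
    by (simp add: f_def abs_mult power_abs divide_right_mono mult_right_mono abs_deg_rising_fact_le)
  have summable_f: "summable (\<lambda>n. norm (f n \<omega>))" for \<omega>
    by (rule summable_comparison_test'[OF sums_summable[OF maj]]) (use f_le in simp)
  have int_f: "integrable M (f n)" for n
    unfolding f_def by (intro integrable_mult_left integrable_divide int')
  \<comment> \<open>The hypothesis of \<open>sums_integral\<close>: all partial sums are bounded by
    the expectation of the majorant.\<close>
  have "summable (\<lambda>n. \<integral>\<omega>. norm (f n \<omega>) \<partial>M)"
  proof (rule summableI_nonneg_bounded)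
    fix n
    have "(\<Sum>i<n. \<integral>\<omega>. norm (f i \<omega>) \<partial>M) = (\<integral>\<omega>. (\<Sum>i<n. norm (f i \<omega>)) \<partial>M)"
      using int_f by simp
    also have "\<dots> \<le> (\<integral>\<omega>. exp (- ln (1 - \<bar>lam * t\<bar>) / \<bar>lam\<bar> * \<bar>Y \<omega>\<bar>) \<partial>M)"
    proof (rule integral_mono[OF _ int])
      fix \<omega>
      have "(\<Sum>i<n. norm (f i \<omega>)) \<le> (\<Sum>i. norm (f i \<omega>))"
        using summable_f by (intro sum_le_suminf) auto
      also have "\<dots> \<le> (\<Sum>i. deg_rising_fact \<bar>lam\<bar> \<bar>Y \<omega>\<bar> i / fact i * \<bar>t\<bar> ^ i)"
        by (intro suminf_le f_le summable_f sums_summable[OF maj])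
      also have "\<dots> = exp (- ln (1 - \<bar>lam * t\<bar>) / \<bar>lam\<bar> * \<bar>Y \<omega>\<bar>)"
        using maj by (simp add: sums_iff)
      finally show "(\<Sum>i<n. norm (f i \<omega>)) \<le> exp (- ln (1 - \<bar>lam * t\<bar>) / \<bar>lam\<bar> * \<bar>Y \<omega>\<bar>)" .
    qed (use int_f in auto)
    finally show "(\<Sum>i<n. \<integral>\<omega>. norm (f i \<omega>) \<partial>M)
        \<le> (\<integral>\<omega>. exp (- ln (1 - \<bar>lam * t\<bar>) / \<bar>lam\<bar> * \<bar>Y \<omega>\<bar>) \<partial>M)" .
  qed simp
  hence "(\<lambda>n. integral\<^sup>L M (f n)) sums (\<integral>\<omega>. (\<Sum>n. f n \<omega>) \<partial>M)"
    using int_f summable_f by (intro sums_integral) auto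
  moreover have "(\<Sum>n. f n \<omega>) = deg_exp lam (- Y \<omega>) (- t)" for \<omega>
    using deg_rising_fps_sums[OF lam t, of "Y \<omega>"] by (simp add: f_def deg_exp_def sums_iff)
  moreover have "integral\<^sup>L M (f n) = (\<integral>\<omega>. deg_rising_fact lam (Y \<omega>) n \<partial>M) / fact n * t ^ n" for n
    by (simp add: f_def[abs_def])
  ultimately show ?thesis
    by simp
qed

lemma deg_exp_integral_has_fps_expansion:
  fixes Y :: "'a \<Rightarrow> real"
  assumes Y: "Y \<in> borel_measurable M"
    and moments: "\<And>m::nat. integrable M (\<lambda>\<omega>. \<bar>Y \<omega>\<bar> ^ m)"
    and r: "r > 0"
    and lim: "\<And>t::real. \<bar>t\<bar> < r \<Longrightarrow>
           (\<lambda>m. \<bar>t\<bar> ^ m * (\<integral>\<omega>. \<bar>Y \<omega>\<bar> ^ m \<partial>M) / fact m) \<longlonglongrightarrow> 0"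
    and lam: "lam \<noteq> 0"
  shows "\<And>n. integrable M (\<lambda>\<omega>. deg_rising_fact lam (Y \<omega>) n)"
    and "(\<lambda>t. \<integral>\<omega>. deg_exp lam (- Y \<omega>) (- t) \<partial>M) has_fps_expansion
      Abs_fps (\<lambda>n. (\<integral>\<omega>. deg_rising_fact lam (Y \<omega>) n \<partial>M) / fact n)"
proof -
  \<comment> \<open>The binomial series converges at \<open>t\<close>, and the exponent of the
    majorant lies below \<open>r\<close>. Both hold near 0, because that exponent tends to 0 with
    \<open>t\<close>.\<close>
  define good where "good t \<longleftrightarrow> \<bar>lam * t\<bar> < 1 \<and> - ln (1 - \<bar>lam * t\<bar>) / \<bar>lam\<bar> < r" for t
  have int: "integrable M (\<lambda>\<omega>. exp (- ln (1 - \<bar>lam * t\<bar>) / \<bar>lam\<bar> * \<bar>Y \<omega>\<bar>))" if "good t" for t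
    using that lam
    by (intro integrable_exp_abs[OF moments lim]) (auto simp: good_def divide_nonpos_pos)
  have "((\<lambda>t. \<bar>lam * t\<bar>) \<longlongrightarrow> \<bar>lam * 0\<bar>) (nhds 0)"
    by (intro tendsto_intros filterlim_ident)
  hence "eventually (\<lambda>t. \<bar>lam * t\<bar> < 1) (nhds 0)"
    by (rule order_tendstoD) simp
  moreover have "((\<lambda>t. - ln (1 - \<bar>lam * t\<bar>) / \<bar>lam\<bar>) \<longlongrightarrow> - ln (1 - \<bar>lam * 0\<bar>) / \<bar>lam\<bar>) (nhds 0)"
    using lam by (intro tendsto_intros filterlim_ident) auto
  hence "eventually (\<lambda>t. - ln (1 - \<bar>lam * t\<bar>) / \<bar>lam\<bar> < r) (nhds 0)"
    by (rule order_tendstoD) (use r in simp)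
  ultimately have ev: "eventually good (nhds 0)"
    unfolding good_def by eventually_elim simp
  \<comment> \<open>Integrability of the rising factorials does not involve \<open>t\<close>, so one
    nonzero good point suffices to obtain it.\<close>
  have "eventually (\<lambda>t. good t \<and> t \<noteq> 0) (at 0)"
    using ev by (auto simp: eventually_at_filter elim: eventually_mono)
  then obtain t where t: "good t" "t \<noteq> 0"
    using eventually_happens[of "\<lambda>t. good t \<and> t \<noteq> 0" "at 0"] by auto
  show int': "integrable M (\<lambda>\<omega>. deg_rising_fact lam (Y \<omega>) n)" for n
    using integrable_deg_rising_fact[OF Y lam _ t(2) int[OF t(1)]] t(1) by (simp add: good_def)
  show "(\<lambda>t. \<integral>\<omega>. deg_exp lam (- Y \<omega>) (- t) \<partial>M) has_fps_expansion
      Abs_fps (\<lambda>n. (\<integral>\<omega>. deg_rising_fact lam (Y \<omega>) n \<partial>M) / fact n)"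
  proof (rule has_fps_expansionI)
    show "\<forall>\<^sub>F u in nhds 0. (\<lambda>n. fps_nth (Abs_fps (\<lambda>n. (\<integral>\<omega>. deg_rising_fact lam (Y \<omega>) n \<partial>M) / fact n)) n
        * u ^ n) sums (\<integral>\<omega>. deg_exp lam (- Y \<omega>) (- u) \<partial>M)"
      using ev
      by eventually_elim (use deg_exp_integral_sums[OF Y lam _ int int'] in \<open>simp add: good_def\<close>)
  qed
qed

section \<open>Powers of the series and sums of independent copies\<close>

lemma (in prob_space) deg_rising_fps_sum_indep:
  fixes Ys :: "nat \<Rightarrow> 'a \<Rightarrow> real"
  assumes lam: "lam \<noteq> 0"
    and indep: "indep_vars (\<lambda>_. borel) Ys {1..}"
    and int: "\<And>i n. i \<ge> 1 \<Longrightarrow> integrable M (\<lambda>\<omega>. deg_rising_fact lam (Ys i \<omega>) n)"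
    and A: "\<And>i. i \<ge> 1 \<Longrightarrow> Abs_fps (\<lambda>n. expectation (\<lambda>\<omega>. deg_rising_fact lam (Ys i \<omega>) n) / fact n) = A"
  shows "(\<forall>n. integrable M (\<lambda>\<omega>. deg_rising_fact lam (\<Sum>i=1..j. Ys i \<omega>) n)) \<and>
    Abs_fps (\<lambda>n. expectation (\<lambda>\<omega>. deg_rising_fact lam (\<Sum>i=1..j. Ys i \<omega>) n) / fact n) = A ^ j"
\<comment> \<open>Integrability is carried through the induction with the identity, since factoring
  the expectation of a product requires both factors to be integrable.\<close>
proof (induction j)
  case 0
  \<comment> \<open>For the empty sum, the factor with index 0 is 0 as soon as \<open>n\<close> is
    positive, so the series is the constant 1.\<close>
  have "deg_rising_fact lam 0 n = (if n = 0 then 1 else 0)" for n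
    by (auto simp: deg_rising_fact_def intro!: bexI[of _ 0])
  thus ?case by (auto simp: fps_eq_iff prob_space)
next
  case (Suc j)
  define S where "S = (\<lambda>\<omega>. \<Sum>i=1..j. Ys i \<omega>)"
  define c where "c x n = deg_rising_fact lam x n / fact n" for x n
  have c_meas: "(\<lambda>x. c x n) \<in> borel_measurable borel" for n
    unfolding c_def by measurable
  have "indep_vars (\<lambda>_. borel) Ys (insert (Suc j) {1..j})"
    by (rule indep_vars_subset[OF indep]) auto
  hence "indep_var borel (Ys (Suc j)) borel S"
    unfolding S_def by (intro indep_vars_sum) auto
  hence ind: "indep_var borel (\<lambda>\<omega>. c (Ys (Suc j) \<omega>) m) borel (\<lambda>\<omega>. c (S \<omega>) n)" for m n
    using indep_var_compose[OF _ c_meas c_meas] by (simp add: o_def)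
  have intY: "integrable M (\<lambda>\<omega>. c (Ys (Suc j) \<omega>) n)" for n
    using int[of "Suc j" n] by (simp add: c_def)
  have intS: "integrable M (\<lambda>\<omega>. c (S \<omega>) n)" for n
    using Suc by (simp add: c_def S_def)
  have AY: "expectation (\<lambda>\<omega>. c (Ys (Suc j) \<omega>) n) = fps_nth A n" for n
    using A[of "Suc j"] by (auto simp: c_def)
  have AS: "expectation (\<lambda>\<omega>. c (S \<omega>) n) = fps_nth (A ^ j) n" for n
    using Suc by (auto simp: c_def S_def fps_eq_iff)
  \<comment> \<open>The addition law, read coefficientwise, gives a finite sum of products of
    independent variables; taking expectations yields the coefficients of
    \<open>A * A ^ j\<close>.\<close>
  have c_eq: "c (\<Sum>i=1..Suc j. Ys i \<omega>) n = (\<Sum>m=0..n. c (Ys (Suc j) \<omega>) m * c (S \<omega>) (n - m))" for \<omega> n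
    using arg_cong[OF deg_rising_fps_add[OF lam, of "Ys (Suc j) \<omega>" "S \<omega>"], of "\<lambda>F. fps_nth F n"]
    by (simp add: fps_mult_nth c_def S_def add.commute)
  have int_c: "integrable M (\<lambda>\<omega>. c (\<Sum>i=1..Suc j. Ys i \<omega>) n)" for n
    unfolding c_eq by (intro Bochner_Integration.integrable_sum indep_var_integrable ind intY intS)
  have "expectation (\<lambda>\<omega>. c (\<Sum>i=1..Suc j. Ys i \<omega>) n) = fps_nth (A ^ Suc j) n" for n
  proof -
    have "expectation (\<lambda>\<omega>. c (\<Sum>i=1..Suc j. Ys i \<omega>) n) =
        (\<Sum>m=0..n. expectation (\<lambda>\<omega>. c (Ys (Suc j) \<omega>) m * c (S \<omega>) (n - m)))"
      unfolding c_eq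
      by (intro Bochner_Integration.integral_sum indep_var_integrable ind intY intS)
    also have "\<dots> = (\<Sum>m=0..n. fps_nth A m * fps_nth (A ^ j) (n - m))"
      by (intro sum.cong refl) (simp add: indep_var_lebesgue_integral[OF ind intY intS] AY AS)
    finally show ?thesis by (simp add: fps_mult_nth)
  qed
  moreover have "integrable M (\<lambda>\<omega>. deg_rising_fact lam (\<Sum>i=1..Suc j. Ys i \<omega>) n)" for n
    using integrable_mult_left[OF int_c[of n], of "fact n"] by (simp add: c_def)
  ultimately show ?case
    by (auto simp: c_def fps_eq_iff)
qed

theorem theorem2p1:
  fixes M :: "'a measure" and Y :: "'a \<Rightarrow> real" and Ys :: "nat \<Rightarrow> 'a \<Rightarrow> real"
    and lam r :: real and n k :: nat
  assumes "prob_space M"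
    and "Y \<in> borel_measurable M"
    and "\<And>m::nat. integrable M (\<lambda>\<omega>. \<bar>Y \<omega>\<bar> ^ m)"
    and "r > 0"
    and "\<And>t::real. \<bar>t\<bar> < r \<Longrightarrow>
           (\<lambda>m. \<bar>t\<bar> ^ m * (\<integral>\<omega>. \<bar>Y \<omega>\<bar> ^ m \<partial>M) / fact m) \<longlonglongrightarrow> 0"
    and "prob_space.indep_vars M (\<lambda>_. borel) Ys {1..}"
    and "\<And>i. i \<ge> 1 \<Longrightarrow> distr M borel (Ys i) = distr M borel Y"
    and "lam \<noteq> 0"
    and "k \<le> n"
  shows "prob_het_stirling2 M Y lam n k =
           1 / fact k * (\<Sum>j=0..k. real (k choose j) * (-1) ^ (k - j) *
             (\<integral>\<omega>. deg_rising_fact lam (\<Sum>i=1..j. Ys i \<omega>) n \<partial>M))"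
proof -
  interpret prob_space M by fact
  define A where "A = Abs_fps (\<lambda>n. expectation (\<lambda>\<omega>. deg_rising_fact lam (Y \<omega>) n) / fact n)"
  note expansion = deg_exp_integral_has_fps_expansion[OF assms(2,3,4,5,8)]
  have meas: "Ys i \<in> borel_measurable M" if "i \<ge> 1" for i
    using assms(6) that by (auto simp: indep_vars_def)
  \<comment> \<open>Only \<open>Y\<close> comes with moment hypotheses; integrability reaches each
    \<open>Ys i\<close> through the common distribution.\<close>
  have int: "integrable M (\<lambda>\<omega>. deg_rising_fact lam (Ys i \<omega>) m)" if "i \<ge> 1" for i m
  proof -
    have "integrable (distr M borel Y) (\<lambda>x. deg_rising_fact lam x m)"
      using expansion(1)[of m] by (subst integrable_distr_eq[OF assms(2)]) auto
    thus ?thesis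
      unfolding assms(7)[OF that, symmetric]
      by (subst (asm) integrable_distr_eq[OF meas[OF that]]) auto
  qed
  have "expectation (\<lambda>\<omega>. deg_rising_fact lam (Ys i \<omega>) m) = expectation (\<lambda>\<omega>. deg_rising_fact lam (Y \<omega>) m)"
    if "i \<ge> 1" for i m
    using integral_distr[OF meas[OF that], of "\<lambda>x. deg_rising_fact lam x m"]
      integral_distr[OF assms(2), of "\<lambda>x. deg_rising_fact lam x m"] assms(7)[OF that]
    by simp
  hence pow: "Abs_fps (\<lambda>n. expectation (\<lambda>\<omega>. deg_rising_fact lam (\<Sum>i=1..j. Ys i \<omega>) n) / fact n) = A ^ j" for j
    using deg_rising_fps_sum_indep[OF assms(8,6) int, of A] by (simp add: A_def)
  have pow_nth: "fps_nth (A ^ j) n = expectation (\<lambda>\<omega>. deg_rising_fact lam (\<Sum>i=1..j. Ys i \<omega>) n) / fact n" for j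
    by (simp flip: pow)
  define F where "F = fps_const (1 / fact k) * (A - 1) ^ k"
  have F: "(\<lambda>t::real. 1 / fact k * ((\<integral>\<omega>. deg_exp lam (- Y \<omega>) (- t) \<partial>M) - 1) ^ k) has_fps_expansion F"
    unfolding F_def A_def
    by (intro has_fps_expansion_cmult_left has_fps_expansion_power has_fps_expansion_diff
        expansion(2) has_fps_expansion_1)
  have "(A - 1) ^ k = (A + (- 1)) ^ k"
    by simp
  also have "\<dots> = (\<Sum>j\<le>k. of_nat (k choose j) * A ^ j * (- 1) ^ (k - j))"
    by (rule binomial_ring)
  \<comment> \<open>Gathering the scalars into \<open>fps_const\<close> makes extraction of the
    \<open>n\<close>-th coefficient linear in the powers \<open>A ^ j\<close>.\<close>
  also have "\<dots> = (\<Sum>j\<le>k. fps_const (real (k choose j) * (- 1) ^ (k - j)) * A ^ j)"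
    by (intro sum.cong refl)
      (simp add: mult_ac fps_of_nat flip: fps_const_mult fps_const_power fps_const_neg fps_const_1_eq_1)
  finally have "fps_nth F n = 1 / fact k * (\<Sum>j\<le>k. real (k choose j) * (- 1) ^ (k - j) * fps_nth (A ^ j) n)"
    by (simp add: F_def fps_sum_nth)
  moreover have "(THE F. (\<lambda>t::real. 1 / fact k * ((\<integral>\<omega>. deg_exp lam (- Y \<omega>) (- t) \<partial>M) - 1) ^ k)
      has_fps_expansion F) = F"
    using F has_fps_expansion_unique by (intro the_equality) blast+
  \<comment> \<open>The factor \<open>fact n\<close> in the definition cancels the denominator in
    \<open>pow_nth\<close>.\<close>
  ultimately show ?thesis
    by (simp add: prob_het_stirling2_def pow_nth atLeast0AtMost sum_distrib_left)
qed

end
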